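(* Let $(L,V,W)=(3,6,4)$, for which $$B(L,V,W)=\left\lceil \frac{(L-1)\operatorname{lcm}(V,W)}{LW}-1\right\rceil W+(L-1)(V-1)=14.$$ The profile $a=(17,16,13,16,17)$, with $n=5$ and $\min_c a_c=13=B-1$, satisfies $\hat K<K^\star$, where $\hat K$ is the output of the algorithm ResidueBound on input $(a,3,6,4)$ and $K^\star$ is the optimum of the $(3,6,4)$ block-cover problem for $a$. Hence, for $(L,V,W)=(3,6,4)$, the condition $\min_c a_c\ge B-1$ does not suffice to guarantee $\hat K=K^\star$.
   Context: Block-cover problem. Fix integers $L\ge2$, $V,W\ge1$ and a profile $a=(a_0,\dots,a_{n-1})\in\mathbb{Z}_{\ge0}^n$. A tiling (feasible solution) consists of nonnegative integers $t_c$ for $0\le c\le n-L$ (number of horizontal blocks of length $L$ whose leftmost cell is column $c$; set $t_c=0$ for all other integers $c$), and nonnegative integers $s_c,f_c$ for $0\le c\le n-1$ (numbers of vertical blocks of value $V$, and of $W$-blocks of value $W$, at column $c$), such that $$a_c=T_c+V s_c+W f_c\quad\text{for all }0\le c\le n-1,\qquad T_c=\sum_{j=0}^{L-1}t_{c-j}.$$ The optimum is $K^\star=\min\sum_{c=0}^{n-1} f_c$ over all tilings, with $K^\star=\infty$ if there is no tiling. Algorithm ResidueBound$(a,L,V,W)$ (for $n\ge L$). Set $y\gets a$. For $i=0,1,\dots,n-L-1$ in this order, replace $y[i+L]$ by $y[i+L]+y[i]$. Let $\sigma=(V-W)\bmod V$. For each $c\in\{1,\dots,L\}$ and each residue $r\in\{0,\dots,V-1\}$,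 let $\mathrm{reach}_c[r]$ be the least $m\in\{0,\dots,V-1\}$ with $(y[n-c]+\sigma m)\bmod V=r$, and $\mathrm{reach}_c[r]=\infty$ if there is none. The output is $\hat K=\min_{0\le r\le V-1}\sum_{c=1}^{L}\mathrm{reach}_c[r]$. *)

theory Defs
  imports Complex_Main "HOL-Library.Extended_Nat"
begin

text \<open>
  A profile is a list of naturals; its length is the number \<open>n\<close> of columns.  Start columns of
  horizontal blocks are integers, so that \<open>c - j\<close> below is never truncated.
\<close>

definition horiz :: "nat \<Rightarrow> (int \<Rightarrow> nat) \<Rightarrow> int \<Rightarrow> nat" where
  "horiz L t c = (\<Sum>j<L. t (c - int j))"

text \<open>The values of \<open>s\<close> and \<open>f\<close> outside the columns \<open>{..<length a}\<close> are irrelevant.\<close>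

definition is_tiling ::
  "nat \<Rightarrow> nat \<Rightarrow> nat \<Rightarrow> nat list \<Rightarrow> (int \<Rightarrow> nat) \<Rightarrow> (nat \<Rightarrow> nat) \<Rightarrow> (nat \<Rightarrow> nat) \<Rightarrow> bool" where
  "is_tiling L V W a t s f \<longleftrightarrow>
     (\<forall>c. \<not> (0 \<le> c \<and> c \<le> int (length a) - int L) \<longrightarrow> t c = 0) \<and>
     (\<forall>c<length a. a ! c = horiz L t (int c) + V * s c + W * f c)"

text \<open>In \<^typ>\<open>enat\<close> the infimum of a nonempty set is attained, and the infimum of the empty set
  is \<open>\<infinity>\<close>.\<close>

definition K_star :: "nat \<Rightarrow> nat \<Rightarrow> nat \<Rightarrow> nat list \<Rightarrow> enat" where
  "K_star L V W a = Inf {enat (\<Sum>c<length a. f c) | t s f. is_tiling L V W a t s f}"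

definition propagate :: "nat \<Rightarrow> nat list \<Rightarrow> nat list" where
  "propagate L a = fold (\<lambda>i y. y[i + L := y ! (i + L) + y ! i]) [0..<length a - L] a"

definition shift :: "nat \<Rightarrow> nat \<Rightarrow> nat" where
  "shift V W = nat ((int V - int W) mod int V)"

definition reach :: "nat \<Rightarrow> nat \<Rightarrow> nat \<Rightarrow> nat \<Rightarrow> enat" where
  "reach V W x r =
     (if \<exists>m<V. (x + shift V W * m) mod V = r
      then enat (LEAST m. m < V \<and> (x + shift V W * m) mod V = r)
      else \<infinity>)"

definition residue_bound :: "nat list \<Rightarrow> nat \<Rightarrow> nat \<Rightarrow> nat \<Rightarrow> enat" where
  "residue_bound a L V W =
     (let y = propagate L a
      in Min ((\<lambda>r. \<Sum>c = 1..L. reach V W (y ! (length a - c)) r) ` {0..<V}))"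

definition B_bound :: "nat \<Rightarrow> nat \<Rightarrow> nat \<Rightarrow> int" where
  "B_bound L V W =
     \<lceil>((real L - 1) * real (lcm V W)) / (real L * real W) - 1\<rceil> * int W
       + (int L - 1) * (int V - 1)"

end

theory Submission
  imports Defs
begin

text \<open>
  With columns numbered from 0, \<open>T\<^sub>2 = T\<^sub>0 + T\<^sub>3\<close>; modulo 6 this gives
  \<open>f\<^sub>0 + f\<^sub>3 \<equiv> f\<^sub>2 + 2 (mod 3)\<close>. A tiling with \<open>f\<close>-sum at most 1 therefore
  has its only \<open>W\<close>-block in column 2. Then \<open>t\<^sub>0\<close> and \<open>t\<^sub>2\<close> are both congruent to 5 modulo 6, so
  \<open>t\<^sub>0 + t\<^sub>2 \<ge> 10\<close>, while column 2 leaves room for only 13 - 4 = 9. The algorithm sees just the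
  residues and accepts the value 1.
\<close>

lemma reach_le:
  assumes "m < V" "(x + shift V W * m) mod V = r"
  shows "reach V W x r \<le> enat m"
  using assms by (auto simp: reach_def intro!: Least_le)

lemma residue_bound_counterexample: "residue_bound [17, 16, 13, 16, 17] 3 6 4 \<le> 1"
proof -
  have upt: "[0..<2] = [0, 1::nat]"
    by (simp add: upt_rec)
  have set: "{1..3} = {1, 2, 3::nat}"
    by auto
  have propagate: "propagate 3 [17, 16, 13, 16, 17] = [17, 16, 13, 33, 33]"
    by (simp add: propagate_def upt numeral_eq_Suc)
  have shift: "shift 6 4 = 2"
    by (simp add: shift_def)
  \<comment> \<open>Any residue bounds the minimum from above; 3 is chosen because both propagated
    entries 33 have it modulo 6.\<close>
  have "residue_bound [17, 16, 13, 16, 17] 3 6 4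
      \<le> (\<Sum>c = 1..3. reach 6 4 ([17, 16, 13, 33, 33] ! (length [17, 16, 13, 16, 17::nat] - c)) 3)"
    unfolding residue_bound_def Let_def propagate
    by (rule Min_le, simp, rule image_eqI[where x = 3], rule refl, simp)
  also have "\<dots> = reach 6 4 33 3 + reach 6 4 33 3 + reach 6 4 13 3"
    unfolding set by simp
  \<comment> \<open>The entries 33 cost nothing, and one shift by 2 takes 13 to 15, which is 3
    modulo 6.\<close>
  also have "\<dots> \<le> enat 0 + enat 0 + enat 1"
    by (intro add_mono reach_le) (simp_all add: shift)
  finally show ?thesis
    by (simp add: one_enat_def)
qed

lemma tiling_counterexample:
  assumes "is_tiling 3 6 4 [17, 16, 13, 16, 17] t s f"
  shows "2 \<le> (\<Sum>c<length [17, 16, 13, 16, 17::nat]. f c)"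
proof (rule ccontr)
  assume "\<not> ?thesis"
  then have sum: "f 0 + f 1 + f 2 + f 3 + f 4 \<le> 1"
    by (simp add: eval_nat_numeral)
  \<comment> \<open>Blocks start only in columns 0 to 2, so column 0 meets only \<open>t 0\<close>
    and column 4 only \<open>t 2\<close>.\<close>
  have outside: "t (-1) = 0" "t (-2) = 0" "t 3 = 0" "t 4 = 0"
    using assms by (auto simp: is_tiling_def)
  have column: "[17, 16, 13, 16, 17] ! c =
      t (int c) + t (int c - 1) + t (int c - 2) + 6 * s c + 4 * f c" if "c < 5" for c
    using assms that by (simp add: is_tiling_def horiz_def numeral_3_eq_3)
  have columns: "17 = t 0 + 6 * s 0 + 4 * f 0"
    "13 = t 0 + t 1 + t 2 + 6 * s 2 + 4 * f 2"
    "16 = t 1 + t 2 + 6 * s 3 + 4 * f 3"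
    "17 = t 2 + 6 * s 4 + 4 * f 4"
    using column[of 0] column[of 2] column[of 3] column[of 4] outside
    by simp_all
  have "f 2 \<noteq> 0"
  proof
    assume "f 2 = 0"
    \<comment> \<open>Column 0 plus column 3 minus column 2 cancels every \<open>t\<close>, and 20
      is 17 + 16 - 13.\<close>
    with columns have "20 + 6 * s 2 = 6 * (s 0 + s 3) + 4 * (f 0 + f 3)"
      by simp
    moreover have "f 0 + f 3 = 0 \<or> f 0 + f 3 = 1"
      using sum by auto
    ultimately show False
      by (elim disjE; simp only:; presburger)
  qed
  with sum have f: "f 0 = 0" "f 4 = 0" "1 \<le> f 2"
    by simp_all
  \<comment> \<open>Without a \<open>W\<close>-block only multiples of 6 come off 17, and 17 is 5
    modulo 6.\<close>
  have "5 \<le> t 0"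
    using columns(1) f(1) by presburger
  moreover have "5 \<le> t 2"
    using columns(4) f(2) by presburger
  ultimately show False
    using columns(2) f(3) by linarith
qed

theorem proposition2:
  shows "B_bound 3 6 4 = 14
    \<and> int (Min (set [17, 16, 13, 16, 17])) = 13
    \<and> 13 = B_bound 3 6 4 - 1
    \<and> residue_bound [17, 16, 13, 16, 17] 3 6 4 < K_star 3 6 4 [17, 16, 13, 16, 17]
    \<and> \<not> (\<forall>a. length a \<ge> 3 \<and> int (Min (set a)) \<ge> B_bound 3 6 4 - 1
             \<longrightarrow> residue_bound a 3 6 4 = K_star 3 6 4 a)"
proof -
  have "lcm 6 4 = (12::nat)"
    by (simp add: lcm_nat_def gcd_non_0_nat)
  then have B: "B_bound 3 6 4 = 14"
    by (simp add: B_bound_def)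
  have min: "int (Min (set [17, 16, 13, 16, 17])) = 13"
    by simp
  \<comment> \<open>A bound on every tiling suffices: over an empty set the infimum would be
    \<open>\<infinity>\<close>.\<close>
  have "2 \<le> K_star 3 6 4 [17, 16, 13, 16, 17]"
    unfolding K_star_def
    by (rule Inf_greatest) (auto simp: numeral_eq_enat dest!: tiling_counterexample)
  moreover have "(1::enat) < 2"
    by simp
  ultimately have lt: "residue_bound [17, 16, 13, 16, 17] 3 6 4 < K_star 3 6 4 [17, 16, 13, 16, 17]"
    using residue_bound_counterexample by order
  have "\<not> (\<forall>a. length a \<ge> 3 \<and> int (Min (set a)) \<ge> B_bound 3 6 4 - 1
             \<longrightarrow> residue_bound a 3 6 4 = K_star 3 6 4 a)"
  proof
    assume *: "\<forall>a. length a \<ge> 3 \<and> int (Min (set a)) \<ge> B_bound 3 6 4 - 1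
             \<longrightarrow> residue_bound a 3 6 4 = K_star 3 6 4 a"
    have "residue_bound [17, 16, 13, 16, 17] 3 6 4 = K_star 3 6 4 [17, 16, 13, 16, 17]"
      by (rule *[rule_format]) (simp add: B)
    with lt show False
      by order
  qed
  then show ?thesis
    by (intro conjI B min lt) (simp add: B)
qed

end
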